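(* For every integer $n\ge 3$, $$J(n,\ast,n-3)=\sum_{k=0}^n(-1)^k\frac{2n}{2n-k}\binom{2n-k}{k}(n-k)!.$$
   Context: A site swap juggling pattern of period $n$ with $b$ balls is an $n$-tuple $(h_0,h_1,\ldots,h_{n-1})$ of non-negative integers such that (1) $i+h_i\not\equiv j+h_j \pmod n$ for all $0\le i<j\le n-1$, and (2) $\sum_{i=0}^{n-1}h_i=bn$. Patterns are counted as ordered $n$-tuples (cyclic shifts are not identified). For an integer $c\ge 0$, $J(n,b,c)$ denotes the number of such patterns with $h_i\le c$ for every $i$, and $J(n,\ast,c)=\sum_{b=0}^{c}J(n,b,c)$ is the number of such patterns with any number of balls. *)

theory Defs
  imports Complex_Main "HOL-Number_Theory.Cong"
begin

text \<open>Patterns are ordered tuples (lists of length \<open>n\<close>); cyclic shifts are not identified.\<close>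

definition site_swap :: "nat \<Rightarrow> nat \<Rightarrow> nat list \<Rightarrow> bool" where
  "site_swap n b h \<longleftrightarrow>
     length h = n \<and>
     (\<forall>i j. i < j \<and> j < n \<longrightarrow> \<not> [i + h ! i = j + h ! j] (mod n)) \<and>
     (\<Sum>i<n. h ! i) = b * n"

definition J :: "nat \<Rightarrow> nat \<Rightarrow> nat \<Rightarrow> nat" where
  "J n b c = card {h. site_swap n b h \<and> (\<forall>i<n. h ! i \<le> c)}"

definition J_any :: "nat \<Rightarrow> nat \<Rightarrow> nat" where
  "J_any n c = (\<Sum>b = 0..c. J n b c)"

end

theory Submission
  imports Defs "HOL-Combinatorics.Permutations"
begin

text \<open>
  Sending a pattern \<open>h\<close> to the landing map \<open>i \<mapsto> (i + h ! i) mod n\<close> turns site swaps into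
  permutations of \<open>{..<n}\<close>. As long as all heights are below \<open>n\<close> nothing is lost, the number of
  balls takes care of itself (the heights sum to a multiple of \<open>n\<close>), and the bound
  \<open>h ! i \<le> n - 3\<close> says exactly that the permutation avoids \<open>i - 2\<close> and \<open>i - 1\<close> modulo \<open>n\<close>
  (\<open>J_any_eq_card_permutations\<close>). So \<open>J_any n (n - 3)\<close> is a menage number, and the formula is
  Touchard's.

  It is obtained by inclusion-exclusion over sets of forbidden entries
  (\<open>card_avoiding_permutations\<close>). The \<open>2 n\<close> forbidden cells of the permutation matrix
  form a cycle in which neighbours share alternately a row and a column, while no other two cells
  share either. Hence a set \<open>S\<close> of cells lies in no permutation if it contains two neighbours,
  and in \<open>(n - card S)!\<close> permutations otherwise (\<open>card_permutations_through_cells\<close>). The number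
  of \<open>k\<close>-subsets of a \<open>2 n\<close>-cycle without neighbours is
  \<open>2 n / (2 n - k) * ((2 n - k) choose k)\<close> (\<open>card_cycle_sparse\<close>, Kaplansky's lemma).
\<close>

section \<open>Subsets without neighbours of a path and of a cycle\<close>

definition sparse :: "nat set \<Rightarrow> bool" where
  "sparse S \<longleftrightarrow> (\<forall>x\<in>S. Suc x \<notin> S)"

definition cycle_sparse :: "nat \<Rightarrow> nat set \<Rightarrow> bool" where
  "cycle_sparse m S \<longleftrightarrow> (\<forall>x\<in>S. Suc x mod m \<notin> S)"

definition path_sparse_sets :: "nat \<Rightarrow> nat \<Rightarrow> nat \<Rightarrow> nat set set" where
  "path_sparse_sets a m k = {S. S \<subseteq> {a..<a+m} \<and> card S = k \<and> sparse S}"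

lemma finite_path_sparse_sets: "finite (path_sparse_sets a m k)"
  by (rule finite_subset[of _ "Pow {a..<a+m}"]) (auto simp: path_sparse_sets_def)

text \<open>Splitting according to whether the last point of the path is chosen; if it is, its
  predecessor is not.\<close>
lemma path_sparse_sets_rec:
  "path_sparse_sets a (Suc (Suc m)) (Suc k) =
     path_sparse_sets a (Suc m) (Suc k) \<union> insert (a + Suc m) ` path_sparse_sets a m k"
  (is "?L = ?A \<union> ?B")
proof
  show "?L \<subseteq> ?A \<union> ?B"
  proof
    fix S assume "S \<in> ?L"
    then have S: "S \<subseteq> {a..<a+Suc (Suc m)}" "card S = Suc k" "sparse S"
      by (auto simp: path_sparse_sets_def)
    show "S \<in> ?A \<union> ?B"
    proof (cases "a + Suc m \<in> S")
      case True
      have "a + m \<notin> S" using S(3) True by (auto simp: sparse_def)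
      have "S - {a + Suc m} \<in> path_sparse_sets a m k"
      proof -
        have "x \<in> {a..<a+m}" if "x \<in> S - {a + Suc m}" for x
        proof -
          have "x \<noteq> a + m" using that \<open>a + m \<notin> S\<close> by blast
          moreover have "a \<le> x" "x < a + Suc (Suc m)" using S(1) that by auto
          ultimately show ?thesis using that by simp
        qed
        then have "S - {a + Suc m} \<subseteq> {a..<a+m}" by blast
        moreover have "card (S - {a + Suc m}) = k" using S(2) True by simp
        moreover have "sparse (S - {a + Suc m})" using S(3) by (auto simp: sparse_def)
        ultimately show ?thesis unfolding path_sparse_sets_def by blast
      qed
      moreover have "S = insert (a + Suc m) (S - {a + Suc m})" using True by auto
      ultimately show ?thesis by blast
    next
      case False
      have "x < a + Suc m" if "x \<in> S" for x
      proof -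
        have "x \<noteq> a + Suc m" using that False by metis
        moreover have "x < a + Suc (Suc m)" using S(1) that by auto
        ultimately show ?thesis by linarith
      qed
      then show ?thesis using S by (auto simp: path_sparse_sets_def)
    qed
  qed
next
  have "insert (a + Suc m) T \<in> ?L" if "T \<in> path_sparse_sets a m k" for T
  proof -
    have T: "T \<subseteq> {a..<a+m}" "card T = k" "sparse T"
      using that by (auto simp: path_sparse_sets_def)
    then have "finite T" "a + Suc m \<notin> T" by (auto intro: finite_subset)
    moreover have "sparse (insert (a + Suc m) T)"
      using T by (fastforce simp: sparse_def)
    ultimately show ?thesis using T by (auto simp: path_sparse_sets_def)
  qed
  then show "?A \<union> ?B \<subseteq> ?L" by (auto simp: path_sparse_sets_def)
qed

lemma inj_on_insert_path_sparse_sets: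
  "a + m \<le> x \<Longrightarrow> inj_on (insert x) (path_sparse_sets a m k)"
proof (rule inj_onI)
  fix S T assume "a + m \<le> x" "S \<in> path_sparse_sets a m k" "T \<in> path_sparse_sets a m k"
    and eq: "insert x S = insert x T"
  then have "x \<notin> S" "x \<notin> T" by (auto simp: path_sparse_sets_def)
  with eq show "S = T" by (simp add: insert_ident)
qed

lemma path_sparse_sets_0: "path_sparse_sets a m 0 = {{}}"
  by (auto simp: path_sparse_sets_def sparse_def finite_subset)

lemma card_path_sparse_sets: "card (path_sparse_sets a m k) = (m + 1 - k) choose k"
proof (induction m arbitrary: k rule: induct_nat_012)
  case 0
  have "path_sparse_sets a 0 k = (if k = 0 then {{}} else {})"
    by (auto simp: path_sparse_sets_def sparse_def)
  then show ?case by (cases k) auto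
next
  case 1
  have "path_sparse_sets a (Suc 0) k = (if k = 0 then {{}} else if k = 1 then {{a}} else {})"
    by (auto simp: path_sparse_sets_def sparse_def subset_singleton_iff)
  moreover have "k = 0 \<or> k = 1 \<or> (\<exists>j. k = Suc (Suc j))" by presburger
  ultimately show ?case by auto
next
  case (ge2 m)
  show ?case
  proof (cases k)
    case 0
    then show ?thesis by (simp add: path_sparse_sets_0)
  next
    case (Suc j)
    have "card (path_sparse_sets a (Suc (Suc m)) (Suc j)) =
        card (path_sparse_sets a (Suc m) (Suc j)) +
        card (insert (a + Suc m) ` path_sparse_sets a m j)"
      unfolding path_sparse_sets_rec
      by (rule card_Un_disjoint) (auto simp: finite_path_sparse_sets, auto simp: path_sparse_sets_def)
    also have "card (insert (a + Suc m) ` path_sparse_sets a m j) = card (path_sparse_sets a m j)"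
      by (intro card_image inj_on_insert_path_sparse_sets) simp
    also have "card (path_sparse_sets a (Suc m) (Suc j)) + card (path_sparse_sets a m j) =
        (Suc m - j choose Suc j) + (m + 1 - j choose j)"
      using ge2 by simp
    also have "\<dots> = (Suc (Suc m) + 1 - Suc j choose Suc j)"
    proof (cases "j \<le> Suc m")
      case True
      then have "Suc (Suc m) + 1 - Suc j = Suc (Suc m - j)" by simp
      then show ?thesis by simp
    next
      case False
      then show ?thesis by (cases j) auto
    qed
    finally show ?thesis using Suc by simp
  qed
qed

text \<open>A cycle is cut open at its last point: if that point is not chosen, a path of \<open>m - 1\<close> points
  remains; if it is, both its neighbours drop out and a path of \<open>m - 3\<close> points remains.\<close>
lemma cycle_sparse_sets_split:
  assumes "m \<ge> 3"
  shows "{S. S \<subseteq> {..<m} \<and> card S = Suc k \<and> cycle_sparse m S} =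
     path_sparse_sets 0 (m - 1) (Suc k) \<union> insert (m - 1) ` path_sparse_sets 1 (m - 3) k"
  (is "?L = ?A \<union> ?B")
proof
  show "?L \<subseteq> ?A \<union> ?B"
  proof
    fix S assume "S \<in> ?L"
    then have S: "S \<subseteq> {..<m}" "card S = Suc k" and cyc: "cycle_sparse m S" by auto
    have sp: "sparse S"
      unfolding sparse_def
    proof (intro ballI notI)
      fix x assume x: "x \<in> S" "Suc x \<in> S"
      then have "Suc x mod m = Suc x" using S by auto
      then show False using cyc x by (auto simp: cycle_sparse_def)
    qed
    show "S \<in> ?A \<union> ?B"
    proof (cases "m - 1 \<in> S")
      case True
      have "0 \<notin> S"
      proof -
        have "Suc (m - 1) mod m = 0" using assms by simp
        then show ?thesis using cyc True unfolding cycle_sparse_def by metis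
      qed
      moreover have "m - 2 \<notin> S"
      proof -
        have "Suc (m - 2) = m - 1" using assms by simp
        then show ?thesis using sp True unfolding sparse_def by metis
      qed
      ultimately have "x \<in> {1..<1+(m-3)}" if "x \<in> S - {m - 1}" for x
      proof -
        have "x \<noteq> m - 2" "x \<noteq> 0" using that \<open>0 \<notin> S\<close> \<open>m - 2 \<notin> S\<close> by (metis DiffD1)+
        moreover have "x < m" "x \<noteq> m - 1" using S(1) that by auto
        ultimately have "1 \<le> x" "x < 1 + (m - 3)" using assms by linarith+
        then show ?thesis by simp
      qed
      then have "S - {m - 1} \<subseteq> {1..<1+(m-3)}" by blast
      moreover have "card (S - {m - 1}) = k" using S(2) True by simp
      moreover have "sparse (S - {m - 1})" using sp by (auto simp: sparse_def)
      ultimately have "S - {m - 1} \<in> path_sparse_sets 1 (m - 3) k"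
        unfolding path_sparse_sets_def by blast
      moreover have "S = insert (m - 1) (S - {m - 1})" using True by auto
      ultimately show ?thesis by blast
    next
      case False
      have "x < m - 1" if "x \<in> S" for x
      proof -
        have "x \<noteq> m - 1" using that False by metis
        moreover have "x < m" using S(1) that by auto
        ultimately show ?thesis by linarith
      qed
      then show ?thesis using S sp by (auto simp: path_sparse_sets_def)
    qed
  qed
next
  have "S \<in> ?L" if "S \<in> ?A" for S
  proof -
    have S: "S \<subseteq> {0..<m-1}" "card S = Suc k" "sparse S"
      using that by (auto simp: path_sparse_sets_def)
    have "Suc x mod m = Suc x" if "x \<in> S" for x
      using S(1) that by (auto intro!: mod_less)
    moreover have "S \<subseteq> {..<m}" using S(1) by auto
    ultimately show ?thesis using S by (auto simp: cycle_sparse_def sparse_def)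
  qed
  moreover have "insert (m - 1) T \<in> ?L" if "T \<in> path_sparse_sets 1 (m - 3) k" for T
  proof -
    have T: "T \<subseteq> {1..<1+(m-3)}" "card T = k" "sparse T"
      using that by (auto simp: path_sparse_sets_def)
    have range: "1 \<le> x" "x < m - 2" if "x \<in> T" for x
    proof -
      have "1 \<le> x" "x < 1 + (m - 3)" using T(1) that by auto
      then show "1 \<le> x" "x < m - 2" using assms by linarith+
    qed
    have "m - 1 \<notin> T" "0 \<notin> T" using range[of "m - 1"] range[of 0] by auto
    have "finite T" using T(1) by (rule finite_subset) simp
    have "cycle_sparse m (insert (m - 1) T)"
      unfolding cycle_sparse_def
    proof
      fix x assume "x \<in> insert (m - 1) T"
      then consider "x = m - 1" | "x \<in> T" by blast
      then show "Suc x mod m \<notin> insert (m - 1) T"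
      proof cases
        case 1
        then have "Suc x mod m = 0" using assms by simp
        then show ?thesis using assms \<open>0 \<notin> T\<close> by simp
      next
        case 2
        then have "x < m - 2" by (rule range)
        then have "Suc x mod m = Suc x" "Suc x \<noteq> m - 1" by auto
        then show ?thesis using 2 T(3) by (simp add: sparse_def)
      qed
    qed
    moreover have "insert (m - 1) T \<subseteq> {..<m}" using range(2) assms by fastforce
    ultimately show ?thesis using T \<open>finite T\<close> \<open>m - 1 \<notin> T\<close> by auto
  qed
  ultimately show "?A \<union> ?B \<subseteq> ?L" by blast
qed

lemma card_cycle_sparse:
  assumes "m \<ge> 3" "k < m"
  shows "real (card {S. S \<subseteq> {..<m} \<and> card S = k \<and> cycle_sparse m S}) =
    real m / (real m - real k) * real ((m - k) choose k)"
proof (cases k)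
  case 0
  have "{S. S \<subseteq> {..<m} \<and> card S = 0 \<and> cycle_sparse m S} = {{}}"
    by (auto simp: cycle_sparse_def finite_subset)
  then show ?thesis using assms 0 by simp
next
  case (Suc j)
  define r where "r = m - k - 1"
  have m: "m = r + j + 2" using assms Suc by (simp add: r_def)
  have "card {S. S \<subseteq> {..<m} \<and> card S = k \<and> cycle_sparse m S} =
      card (path_sparse_sets 0 (m - 1) (Suc j)) + card (insert (m - 1) ` path_sparse_sets 1 (m - 3) j)"
    unfolding Suc cycle_sparse_sets_split[OF assms(1)]
    by (rule card_Un_disjoint) (auto simp: finite_path_sparse_sets, auto simp: path_sparse_sets_def)
  also have "card (insert (m - 1) ` path_sparse_sets 1 (m - 3) j) = card (path_sparse_sets 1 (m - 3) j)"
    using assms by (intro card_image inj_on_insert_path_sparse_sets) simp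
  also have "card (path_sparse_sets 0 (m - 1) (Suc j)) + card (path_sparse_sets 1 (m - 3) j) =
      (Suc r choose Suc j) + (r choose j)"
  proof -
    have "m - 1 + 1 - Suc j = Suc r" "m - 3 + 1 - j = r" using m assms by auto
    then show ?thesis by (simp add: card_path_sparse_sets)
  qed
  finally have count: "card {S. S \<subseteq> {..<m} \<and> card S = k \<and> cycle_sparse m S} =
      (Suc r choose Suc j) + (r choose j)" .
  have "real (Suc r) * real (r choose j) = real (Suc j) * real (Suc r choose Suc j)"
    using Suc_times_binomial[of j r] by (metis of_nat_mult)
  then have "real (Suc r) * real ((Suc r choose Suc j) + (r choose j)) =
      real m * real (Suc r choose Suc j)"
    unfolding m by (simp add: algebra_simps)
  moreover have "real m - real k = real (Suc r)" "m - k = Suc r" using m Suc by auto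
  ultimately show ?thesis
    unfolding count using Suc by (simp add: field_simps)
qed

section \<open>Permutations through prescribed cells\<close>

text \<open>The prescribed values extend to one permutation \<open>p\<close> of \<open>A\<close>; the others are \<open>p \<circ> q\<close> with \<open>q\<close>
  a permutation of the \<open>card A - card S\<close> points left free.\<close>
lemma card_permutations_prescribed:
  assumes "finite A" "inj_on a S" "inj_on b S" "a ` S \<subseteq> A" "b ` S \<subseteq> A"
  shows "card {f. f permutes A \<and> (\<forall>s\<in>S. f (a s) = b s)} = fact (card A - card S)"
proof -
  have cards: "card (A - a ` S) = card A - card S" "card (A - b ` S) = card A - card S"
    using assms by (auto simp: card_Diff_subset card_image finite_subset)
  then obtain h where h: "bij_betw h (A - a ` S) (A - b ` S)"
    using finite_same_card_bij[of "A - a ` S" "A - b ` S"] assms(1) by auto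
  define p where "p x = (if x \<in> a ` S then b (inv_into S a x) else if x \<in> A then h x else x)" for x
  have pa: "p (a s) = b s" if "s \<in> S" for s
    using that assms(2) by (simp add: p_def)
  have "bij_betw p (a ` S) (b ` S)"
  proof (rule bij_betw_imageI)
    show "inj_on p (a ` S)" using assms(3) pa by (auto simp: inj_on_def)
    show "p ` a ` S = b ` S" using pa by (force simp: image_image)
  qed
  moreover have "bij_betw p (A - a ` S) (A - b ` S)"
    using h by (rule bij_betw_cong[THEN iffD1, rotated]) (auto simp: p_def)
  ultimately have "bij_betw p (a ` S \<union> (A - a ` S)) (b ` S \<union> (A - b ` S))"
    by (rule bij_betw_combine) auto
  moreover have "a ` S \<union> (A - a ` S) = A" "b ` S \<union> (A - b ` S) = A" using assms by auto
  ultimately have p: "p permutes A"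
    using assms(4) by (intro bij_imp_permutes) (auto simp: p_def)
  have "{f. f permutes A \<and> (\<forall>s\<in>S. f (a s) = b s)} = (\<circ>) p ` {q. q permutes (A - a ` S)}"
  proof
    show "(\<circ>) p ` {q. q permutes (A - a ` S)} \<subseteq> {f. f permutes A \<and> (\<forall>s\<in>S. f (a s) = b s)}"
    proof clarify
      fix q assume q: "q permutes (A - a ` S)"
      then have "q permutes A" by (rule permutes_subset) auto
      then have "p \<circ> q permutes A" using p by (rule permutes_compose)
      moreover have "(p \<circ> q) (a s) = b s" if "s \<in> S" for s
        using permutes_not_in[OF q, of "a s"] pa that by auto
      ultimately show "p \<circ> q permutes A \<and> (\<forall>s\<in>S. (p \<circ> q) (a s) = b s)" by blast
    qed
  next
    show "{f. f permutes A \<and> (\<forall>s\<in>S. f (a s) = b s)} \<subseteq> (\<circ>) p ` {q. q permutes (A - a ` S)}"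
    proof clarify
      fix f assume f: "f permutes A" "\<forall>s\<in>S. f (a s) = b s"
      have "inv p \<circ> f permutes A" using f(1) permutes_inv[OF p] by (rule permutes_compose)
      moreover have "(inv p \<circ> f) x = x" if "x \<in> A - (A - a ` S)" for x
        using that f(2) pa permutes_inverses(2)[OF p] by (metis DiffD1 DiffD2 DiffI comp_apply imageE)
      ultimately have "inv p \<circ> f permutes (A - a ` S)"
        by (rule permutes_superset) 
      moreover have "f = p \<circ> (inv p \<circ> f)" using permutes_inverses(1)[OF p] by auto
      ultimately show "f \<in> (\<circ>) p ` {q. q permutes (A - a ` S)}" by blast
    qed
  qed
  moreover have "inj_on ((\<circ>) p) {q. q permutes (A - a ` S)}"
    using permutes_inj[OF p] by (auto simp: inj_on_def fun_eq_iff)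
  ultimately show ?thesis
    using cards card_permutations[OF cards(1)] assms(1) by (simp add: card_image)
qed

text \<open>Inclusion-exclusion in the form of expanding the product of the
  indicators \<open>1 - of_bool (f (a s) = b s)\<close>.\<close>
lemma card_avoiding_permutations:
  assumes "finite A" "finite I"
  shows "real (card {f. f permutes A \<and> (\<forall>s\<in>I. f (a s) \<noteq> b s)}) =
    (\<Sum>S\<in>Pow I. (- 1) ^ card S * real (card {f. f permutes A \<and> (\<forall>s\<in>S. f (a s) = b s)}))"
proof -
  let ?P = "{f. f permutes A}"
  have fin: "finite ?P" using assms(1) by (rule finite_permutations)
  have count: "real (card {f. f permutes A \<and> Q f}) = (\<Sum>f\<in>?P. of_bool (Q f))" for Q
  proof -
    have "{f. f permutes A \<and> Q f} = ?P \<inter> {f. Q f}" by blast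
    then show ?thesis using fin by (simp only: sum_of_bool_eq)
  qed
  have all: "of_bool (\<forall>s\<in>T. Q s) = (\<Prod>s\<in>T. (of_bool (Q s) :: real))" if "finite T" for T and Q :: "'b \<Rightarrow> bool"
    using that by (induction T rule: finite_induct) auto
  have expand: "of_bool (\<forall>s\<in>I. f (a s) \<noteq> b s) =
      (\<Sum>S\<in>Pow I. (- 1) ^ card S * (of_bool (\<forall>s\<in>S. f (a s) = b s) :: real))" for f
  proof -
    have "of_bool (\<forall>s\<in>I. f (a s) \<noteq> b s) = (\<Prod>s\<in>I. - of_bool (f (a s) = b s) + (1 :: real))"
      unfolding all[OF assms(2)] by (rule prod.cong) auto
    also have "\<dots> = (\<Sum>S\<in>Pow I. \<Prod>s\<in>S. - (of_bool (f (a s) = b s) :: real))"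
      unfolding prod_add[OF assms(2)] by simp
    also have "\<dots> = (\<Sum>S\<in>Pow I. (- 1) ^ card S * (of_bool (\<forall>s\<in>S. f (a s) = b s) :: real))"
    proof (rule sum.cong[OF refl])
      fix S assume "S \<in> Pow I"
      then have S: "finite S" using assms(2) by (auto intro: finite_subset)
      show "(\<Prod>s\<in>S. - (of_bool (f (a s) = b s) :: real)) =
          (- 1) ^ card S * of_bool (\<forall>s\<in>S. f (a s) = b s)"
        unfolding all[OF S] by (simp add: prod_uminus)
    qed
    finally show ?thesis .
  qed
  show ?thesis
    unfolding count expand by (subst sum.swap) (simp add: sum_distrib_left)
qed

section \<open>The cycle of forbidden cells\<close>

text \<open>The forbidden cells \<open>(i, i - 2)\<close> and \<open>(i, i - 1)\<close> receive the numbers \<open>2 * i\<close> and \<open>2 * i + 1\<close>.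
  In this order the pairs \<open>2 * i\<close>, \<open>2 * i + 1\<close> share a row, the pairs \<open>2 * i + 1\<close>, \<open>2 * i + 2\<close>
  a column. The summand \<open>n - 2\<close> stands for \<open>- 2\<close> modulo \<open>n\<close>.\<close>

definition cell_row :: "nat \<Rightarrow> nat" where
  "cell_row p = p div 2"

definition cell_col :: "nat \<Rightarrow> nat \<Rightarrow> nat" where
  "cell_col n p = (Suc p div 2 + (n - 2)) mod n"

lemma shift_mod_inj:
  fixes x y c n :: nat
  assumes "(x + c) mod n = (y + c) mod n" "x < n" "y < n"
  shows "x = y"
  using assms by (metis cong_add_rcancel_nat cong_def mod_less)

text \<open>Cells \<open>2 * i\<close> and \<open>2 * i + 1\<close> together would give \<open>f\<close> two values at \<open>i\<close>; cells
  \<open>2 * i + 1\<close> and \<open>2 * i + 2\<close> would give it the same value at \<open>i\<close> and at \<open>i + 1\<close>.\<close>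
lemma permutation_cells_cycle_sparse:
  assumes "n \<ge> 3" "S \<subseteq> {..<2 * n}" "f permutes {..<n}" "\<forall>p\<in>S. f (cell_row p) = cell_col n p"
  shows "cycle_sparse (2 * n) S"
  unfolding cycle_sparse_def
proof (intro ballI notI)
  fix p assume p: "p \<in> S" and q: "Suc p mod (2 * n) \<in> S"
  have pn: "p < 2 * n" using p assms(2) by auto
  show False
  proof (cases "even p")
    case True
    then obtain i where i: "p = 2 * i" by (elim evenE)
    then have "Suc p mod (2 * n) = Suc (2 * i)" using pn by auto
    then have "f (cell_row (Suc (2 * i))) = cell_col n (Suc (2 * i))"
      "f (cell_row (2 * i)) = cell_col n (2 * i)"
      using p q i assms(4) by auto
    then have "(1 + (i + (n - 2))) mod n = (0 + (i + (n - 2))) mod n"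
      by (simp add: cell_row_def cell_col_def)
    from shift_mod_inj[OF this] assms(1) show False by simp
  next
    case False
    then obtain i where i: "p = 2 * i + 1" by (elim oddE)
    have "Suc p mod (2 * n) = 2 * (Suc i mod n)"
      unfolding mult_mod_right using i by simp
    then have "f (Suc i mod n) = (Suc i mod n + (n - 2)) mod n"
      using q assms(4) by (auto simp: cell_row_def cell_col_def)
    moreover have "f i = (Suc i + (n - 2)) mod n"
      using p i assms(4) by (auto simp: cell_row_def cell_col_def)
    ultimately have "f (Suc i mod n) = f i" by (simp add: mod_add_left_eq)
    then have "Suc i mod n = i" using permutes_inj[OF assms(3)] by (auto dest: injD)
    moreover have "i < n" using pn i by auto
    ultimately show False using assms(1) by (cases "Suc i = n") auto
  qed
qed

lemma inj_on_cell_row: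
  assumes "S \<subseteq> {..<2 * n}" "cycle_sparse (2 * n) S"
  shows "inj_on cell_row S"
proof (rule linorder_inj_onI')
  fix p q assume pq: "p < q" "p \<in> S" "q \<in> S"
  show "cell_row p \<noteq> cell_row q"
  proof
    assume "cell_row p = cell_row q"
    with pq(1) have "q = Suc p" by (simp add: cell_row_def)
    moreover have "q < 2 * n" using pq assms by auto
    ultimately show False using pq assms(2) by (auto simp: cycle_sparse_def)
  qed
qed

text \<open>Two cells in one column are \<open>2 * i + 1\<close> and \<open>2 * i + 2\<close>, or the last and the first one.\<close>
lemma inj_on_cell_col:
  assumes "n \<ge> 3" "S \<subseteq> {..<2 * n}" "cycle_sparse (2 * n) S"
  shows "inj_on (cell_col n) S"
proof (rule linorder_inj_onI')
  fix p q assume pq: "p < q" "p \<in> S" "q \<in> S"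
  have bounds: "p < 2 * n" "q < 2 * n" using pq assms by auto
  show "cell_col n p \<noteq> cell_col n q"
  proof
    assume eq: "cell_col n p = cell_col n q"
    have "Suc p mod (2 * n) = q \<or> Suc q mod (2 * n) = p"
    proof (cases "Suc q div 2 = n")
      case True
      then have q: "Suc q = 2 * n" using bounds by presburger
      have "(Suc p div 2 + (n - 2)) mod n = (0 + (n - 2)) mod n"
        using eq True by (simp add: cell_col_def)
      moreover have "Suc p div 2 < n" using q pq(1) by presburger
      ultimately have "Suc p div 2 = 0" using shift_mod_inj assms(1) by (metis gr_zeroI not_less_zero)
      then show ?thesis using q by (cases p) auto
    next
      case False
      have "Suc p div 2 \<le> Suc q div 2" "Suc q div 2 \<le> n"
        using bounds pq(1) by (auto intro: div_le_mono)
      with False have "Suc q div 2 < n" "Suc p div 2 < n" by linarith+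
      then have "Suc p div 2 = Suc q div 2" using eq shift_mod_inj unfolding cell_col_def by blast
      then have "q = Suc p" using pq(1) by presburger
      then show ?thesis using bounds by simp
    qed
    then show False using pq assms(3) by (auto simp: cycle_sparse_def)
  qed
qed

lemma card_permutations_through_cells:
  assumes "n \<ge> 3" "S \<subseteq> {..<2 * n}"
  shows "card {f. f permutes {..<n} \<and> (\<forall>p\<in>S. f (cell_row p) = cell_col n p)} =
    (if cycle_sparse (2 * n) S then fact (n - card S) else 0)"
proof (cases "cycle_sparse (2 * n) S")
  case True
  have "cell_row ` S \<subseteq> {..<n}" "cell_col n ` S \<subseteq> {..<n}"
    using assms by (auto simp: cell_row_def cell_col_def)
  then show ?thesis
    using card_permutations_prescribed[of "{..<n}" cell_row S "cell_col n"] True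
      inj_on_cell_row[OF assms(2) True] inj_on_cell_col[OF assms True] by simp
next
  case False
  then have "{f. f permutes {..<n} \<and> (\<forall>p\<in>S. f (cell_row p) = cell_col n p)} = {}"
    using permutation_cells_cycle_sparse[OF assms] by blast
  then show ?thesis using False by (simp only: card.empty if_False)
qed

lemma card_cycle_sparse_le:
  assumes "n \<ge> 3" "S \<subseteq> {..<2 * n}" "cycle_sparse (2 * n) S"
  shows "card S \<le> n"
proof -
  have "cell_row ` S \<subseteq> {..<n}" using assms by (auto simp: cell_row_def)
  then have "card (cell_row ` S) \<le> card {..<n}" by (rule card_mono[rotated]) simp
  then show ?thesis using inj_on_cell_row[OF assms(2,3)] by (simp add: card_image)
qed

lemma card_menage_permutations:
  assumes "n \<ge> 3"
  shows "real (card {f. f permutes {..<n} \<and> (\<forall>p\<in>{..<2 * n}. f (cell_row p) \<noteq> cell_col n p)}) =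
    (\<Sum>k = 0..n. (- 1) ^ k * (2 * real n / (2 * real n - real k)) *
       real ((2 * n - k) choose k) * fact (n - k))"
proof -
  let ?C = "{S. S \<subseteq> {..<2 * n} \<and> cycle_sparse (2 * n) S}"
  have fin: "finite ?C" by (rule finite_subset[of _ "Pow {..<2 * n}"]) auto
  have "real (card {f. f permutes {..<n} \<and> (\<forall>p\<in>{..<2 * n}. f (cell_row p) \<noteq> cell_col n p)}) =
      (\<Sum>S\<in>Pow {..<2 * n}. (- 1) ^ card S *
        real (if cycle_sparse (2 * n) S then fact (n - card S) else 0))"
    unfolding card_avoiding_permutations[OF finite_lessThan finite_lessThan]
    by (rule sum.cong[OF refl]) (simp add: card_permutations_through_cells[OF assms])
  also have "\<dots> = (\<Sum>S\<in>?C. (- 1) ^ card S * fact (n - card S))"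
    by (rule sum.mono_neutral_cong_right) auto
  also have "\<dots> = (\<Sum>k = 0..n. \<Sum>S | S \<in> ?C \<and> card S = k. (- 1) ^ card S * fact (n - card S))"
    using fin card_cycle_sparse_le[OF assms] by (intro sum.group[symmetric]) auto
  also have "\<dots> = (\<Sum>k = 0..n. (- 1) ^ k * (2 * real n / (2 * real n - real k)) *
       real ((2 * n - k) choose k) * fact (n - k))"
  proof (rule sum.cong[OF refl])
    fix k assume "k \<in> {0..n}"
    then have k: "k < 2 * n" using assms by auto
    have "(\<Sum>S | S \<in> ?C \<and> card S = k. (- 1) ^ card S * fact (n - card S)) =
        (\<Sum>S | S \<in> ?C \<and> card S = k. (- 1) ^ k * (fact (n - k) :: real))"
      by (rule sum.cong) auto
    also have "\<dots> = real (card {S. S \<in> ?C \<and> card S = k}) * ((- 1) ^ k * fact (n - k))"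
      by (simp only: sum_constant)
    also have "real (card {S. S \<in> ?C \<and> card S = k}) =
        2 * real n / (2 * real n - real k) * real ((2 * n - k) choose k)"
    proof -
      have "{S. S \<in> ?C \<and> card S = k} = {S. S \<subseteq> {..<2 * n} \<and> card S = k \<and> cycle_sparse (2 * n) S}"
        by auto
      then show ?thesis using card_cycle_sparse[of "2 * n" k] assms k by simp
    qed
    finally show "(\<Sum>S | S \<in> ?C \<and> card S = k. (- 1) ^ card S * fact (n - card S)) =
        (- 1) ^ k * (2 * real n / (2 * real n - real k)) *
          real ((2 * n - k) choose k) * fact (n - k)"
      by (simp add: mult_ac)
  qed
  finally show ?thesis .
qed

section \<open>Patterns as permutations\<close>

definition bounded_patterns :: "nat \<Rightarrow> nat \<Rightarrow> nat list set" where
  "bounded_patterns n c = {h. length h = n \<and> inj_on (\<lambda>i. (i + h ! i) mod n) {..<n} \<and> (\<forall>i<n. h ! i \<le> c)}"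

lemma finite_bounded_patterns: "finite (bounded_patterns n c)"
proof (rule finite_subset)
  show "bounded_patterns n c \<subseteq> {h. set h \<subseteq> {..c} \<and> length h = n}"
    by (auto simp: bounded_patterns_def in_set_conv_nth)
qed (rule finite_lists_length_eq, simp)

lemma landing_map_inj_iff:
  "(\<forall>i j. i < j \<and> j < n \<longrightarrow> \<not> [i + h ! i = j + h ! j] (mod n)) \<longleftrightarrow>
    inj_on (\<lambda>i. (i + h ! i) mod n) {..<n}"
  (is "?L \<longleftrightarrow> ?R")
proof
  assume L: ?L
  show ?R
    by (rule linorder_inj_onI') (use L in \<open>auto simp: cong_def\<close>)
next
  assume R: ?R
  show ?L
  proof (intro allI impI notI)
    fix i j assume "i < j \<and> j < n" "[i + h ! i = j + h ! j] (mod n)"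
    then show False using inj_onD[OF R, of i j] by (auto simp: cong_def)
  qed
qed

text \<open>The landing map rearranges \<open>{..<n}\<close>, so \<open>\<Sum>i<n. i + h ! i\<close> and \<open>\<Sum>i<n. i\<close> agree modulo \<open>n\<close>.\<close>
lemma dvd_sum_heights:
  assumes "inj_on (\<lambda>i. (i + h ! i) mod n) {..<n}"
  shows "n dvd (\<Sum>i<n. h ! i)"
proof (cases "n = 0")
  case False
  have "(\<lambda>i. (i + h ! i) mod n) ` {..<n} = {..<n}"
    using False assms by (intro endo_inj_surj) auto
  then have "(\<Sum>i<n. (i + h ! i) mod n) = (\<Sum>i<n. i)"
    using sum.reindex[OF assms, of "\<lambda>i. i"] by simp
  then have "[(\<Sum>i<n. i + h ! i) = (\<Sum>i<n. i)] (mod n)"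
    by (metis cong_def mod_sum_eq)
  then have "[(\<Sum>i<n. i) + (\<Sum>i<n. h ! i) = (\<Sum>i<n. i) + 0] (mod n)"
    by (simp add: sum.distrib)
  then show ?thesis by (simp only: cong_add_lcancel_nat cong_0_iff)
qed simp

lemma J_any_eq_card_bounded_patterns:
  assumes "n > 0"
  shows "J_any n c = card (bounded_patterns n c)"
proof -
  let ?P = "\<lambda>b. {h. site_swap n b h \<and> (\<forall>i<n. h ! i \<le> c)}"
  have sub: "?P b \<subseteq> bounded_patterns n c" for b
    by (auto simp: site_swap_def bounded_patterns_def landing_map_inj_iff)
  have "bounded_patterns n c \<subseteq> (\<Union>b\<in>{0..c}. ?P b)"
  proof
    fix h assume h: "h \<in> bounded_patterns n c"
    then have "n dvd (\<Sum>i<n. h ! i)" by (auto simp: bounded_patterns_def intro: dvd_sum_heights)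
    then obtain b where b: "(\<Sum>i<n. h ! i) = b * n" by (metis dvdE mult.commute)
    have "(\<Sum>i<n. h ! i) \<le> (\<Sum>i<n. c)"
      using h by (intro sum_mono) (auto simp: bounded_patterns_def)
    then have "b \<le> c" using b assms by (simp add: mult.commute)
    then show "h \<in> (\<Union>b\<in>{0..c}. ?P b)"
      using h b by (auto simp: bounded_patterns_def site_swap_def landing_map_inj_iff)
  qed
  then have "bounded_patterns n c = (\<Union>b\<in>{0..c}. ?P b)" using sub by blast
  also have "card \<dots> = (\<Sum>b = 0..c. card (?P b))"
  proof (rule card_UN_disjoint)
    show "\<forall>b\<in>{0..c}. finite (?P b)" using finite_subset[OF sub finite_bounded_patterns] by blast
    show "\<forall>b\<in>{0..c}. \<forall>b'\<in>{0..c}. b \<noteq> b' \<longrightarrow> ?P b \<inter> ?P b' = {}"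
    proof -
      have "b = b'" if "h \<in> ?P b" "h \<in> ?P b'" for h b b'
      proof -
        have "(\<Sum>i<n. h ! i) = b * n" "(\<Sum>i<n. h ! i) = b' * n"
          using that unfolding site_swap_def by blast+
        then show ?thesis using assms by simp
      qed
      then show ?thesis by blast
    qed
  qed simp
  finally show ?thesis by (simp add: J_any_def J_def)
qed

lemma avoids_cells_iff:
  "(\<forall>p\<in>{..<2 * n}. f (cell_row p) \<noteq> cell_col n p) \<longleftrightarrow>
    (\<forall>i<n. f i \<noteq> (i + (n - 2)) mod n \<and> f i \<noteq> (Suc i + (n - 2)) mod n)"
proof (intro iffI allI impI ballI)
  fix i assume *: "\<forall>p\<in>{..<2 * n}. f (cell_row p) \<noteq> cell_col n p" "i < n"
  then have "2 * i < 2 * n" "2 * i + 1 < 2 * n" by auto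
  with * have "f (cell_row (2 * i)) \<noteq> cell_col n (2 * i)" "f (cell_row (2 * i + 1)) \<noteq> cell_col n (2 * i + 1)"
    by blast+
  then show "f i \<noteq> (i + (n - 2)) mod n \<and> f i \<noteq> (Suc i + (n - 2)) mod n"
    by (simp add: cell_row_def cell_col_def)
next
  fix p assume *: "\<forall>i<n. f i \<noteq> (i + (n - 2)) mod n \<and> f i \<noteq> (Suc i + (n - 2)) mod n" "p \<in> {..<2 * n}"
  then have "p div 2 < n" by auto
  moreover have "Suc p div 2 = p div 2 \<or> Suc p div 2 = Suc (p div 2)" by presburger
  ultimately show "f (cell_row p) \<noteq> cell_col n p"
    using * unfolding cell_row_def cell_col_def by metis
qed

text \<open>A height below \<open>n\<close> is recovered from its landing place \<open>y\<close> as \<open>(y + n - i) mod n\<close>; the two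
  values \<open>n - 2\<close> and \<open>n - 1\<close> excluded by the bound are the two forbidden landing places.\<close>
lemma height_le_iff:
  fixes n i y :: nat
  assumes "n \<ge> 3" "i < n" "y < n"
  shows "(y + n - i) mod n \<le> n - 3 \<longleftrightarrow> y \<noteq> (i + (n - 2)) mod n \<and> y \<noteq> (Suc i + (n - 2)) mod n"
proof -
  have m: "x mod n = (if x < n then x else x - n)" if "x < 2 * n" for x
    using that by (simp add: mod_if)
  have height: "(y + n - i) mod n = (if y < i then y + n - i else y - i)"
    using assms by (subst m) auto
  have col1: "(i + (n - 2)) mod n = (if i < 2 then i + (n - 2) else i - 2)"
    using assms by (subst m) auto
  have col2: "(Suc i + (n - 2)) mod n = (if i < 1 then n - 1 else i - 1)"
    using assms by (subst m) auto
  consider "i = 0" | "i = 1" | "i \<ge> 2" by linarith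
  then show ?thesis
  proof cases
    case 1
    then show ?thesis unfolding height col1 col2 using assms by simp arith
  next
    case 2
    then show ?thesis unfolding height col1 col2 using assms by (cases "y = 0") (simp_all, arith+)
  next
    case 3
    show ?thesis
    proof (cases "y < i")
      case True
      with 3 show ?thesis unfolding height col1 col2 using assms by simp arith
    next
      case False
      with 3 show ?thesis unfolding height col1 col2 using assms by simp arith
    qed
  qed
qed

lemma J_any_eq_card_permutations:
  assumes "n \<ge> 3"
  shows "J_any n (n - 3) =
    card {f. f permutes {..<n} \<and> (\<forall>p\<in>{..<2 * n}. f (cell_row p) \<noteq> cell_col n p)}"
proof -
  let ?F = "{f. f permutes {..<n} \<and>
    (\<forall>i<n. f i \<noteq> (i + (n - 2)) mod n \<and> f i \<noteq> (Suc i + (n - 2)) mod n)}"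
  define to_perm where "to_perm h i = (if i < n then (i + h ! i) mod n else i)" for h and i :: nat
  define to_pattern where "to_pattern f = map (\<lambda>i. (f i + n - i) mod n) [0..<n]" for f :: "nat \<Rightarrow> nat"
  have height: "((i + x) mod n + n - i) mod n = x" if "i < n" "x < n" for i x
  proof -
    have "(i + x) mod n = (if i + x < n then i + x else i + x - n)" using that by (simp add: mod_if)
    then show ?thesis using that by (auto simp: mod_if)
  qed
  have landing: "(i + (y + n - i) mod n) mod n = y" if "i < n" "y < n" for i y
  proof -
    have "(i + (y + n - i) mod n) mod n = (i + (y + n - i)) mod n" by (rule mod_add_right_eq)
    then show ?thesis using that by simp
  qed
  have lt: "f i < n" if "f permutes {..<n}" "i < n" for f i
    using permutes_in_image[OF that(1), of i] that(2) by simp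
  have "bij_betw to_perm (bounded_patterns n (n - 3)) ?F"
  proof (rule bij_betw_byWitness[where f' = to_pattern])
    show "\<forall>h\<in>bounded_patterns n (n - 3). to_pattern (to_perm h) = h"
    proof
      fix h assume "h \<in> bounded_patterns n (n - 3)"
      then have h: "length h = n" "\<And>i. i < n \<Longrightarrow> h ! i \<le> n - 3" by (auto simp: bounded_patterns_def)
      have "h ! i < n" if "i < n" for i using h(2)[OF that] assms by linarith
      then show "to_pattern (to_perm h) = h"
        using h(1) height by (intro nth_equalityI) (auto simp: to_pattern_def to_perm_def)
    qed
    show "\<forall>f\<in>?F. to_perm (to_pattern f) = f"
      using landing lt by (auto simp: to_perm_def to_pattern_def fun_eq_iff permutes_not_in)
    show "to_perm ` bounded_patterns n (n - 3) \<subseteq> ?F"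
    proof clarify
      fix h assume "h \<in> bounded_patterns n (n - 3)"
      then have h: "inj_on (\<lambda>i. (i + h ! i) mod n) {..<n}" "\<And>i. i < n \<Longrightarrow> h ! i \<le> n - 3"
        by (auto simp: bounded_patterns_def)
      have "inj_on (to_perm h) {..<n}"
        using h(1) by (rule inj_on_cong[THEN iffD2, rotated]) (simp add: to_perm_def)
      moreover have "to_perm h ` {..<n} \<subseteq> {..<n}" by (auto simp: to_perm_def)
      ultimately have "bij_betw (to_perm h) {..<n} {..<n}"
        unfolding bij_betw_def using endo_inj_surj finite_lessThan by blast
      then have "to_perm h permutes {..<n}"
        by (rule bij_imp_permutes) (simp add: to_perm_def)
      moreover have "to_perm h i \<noteq> (i + (n - 2)) mod n \<and> to_perm h i \<noteq> (Suc i + (n - 2)) mod n"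
        if "i < n" for i
      proof -
        have "h ! i < n" using h(2)[OF that] assms by linarith
        then have "(to_perm h i + n - i) mod n \<le> n - 3"
          using h(2)[OF that] height[OF that] that by (simp add: to_perm_def)
        moreover have "to_perm h i < n" using that by (simp add: to_perm_def)
        ultimately show ?thesis using height_le_iff[OF assms that] by blast
      qed
      ultimately show "to_perm h permutes {..<n} \<and>
          (\<forall>i<n. to_perm h i \<noteq> (i + (n - 2)) mod n \<and> to_perm h i \<noteq> (Suc i + (n - 2)) mod n)"
        by blast
    qed
    show "to_pattern ` ?F \<subseteq> bounded_patterns n (n - 3)"
    proof clarify
      fix f assume f: "f permutes {..<n}"
        "\<forall>i<n. f i \<noteq> (i + (n - 2)) mod n \<and> f i \<noteq> (Suc i + (n - 2)) mod n"
      have "(i + to_pattern f ! i) mod n = f i" if "i < n" for i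
        using landing lt[OF f(1)] that by (simp add: to_pattern_def)
      then have "inj_on (\<lambda>i. (i + to_pattern f ! i) mod n) {..<n}"
        using permutes_inj_on[OF f(1)] by (subst inj_on_cong[where g = f]) auto
      moreover have "to_pattern f ! i \<le> n - 3" if "i < n" for i
        using height_le_iff[OF assms that lt[OF f(1) that]] f(2) that by (simp add: to_pattern_def)
      ultimately show "to_pattern f \<in> bounded_patterns n (n - 3)"
        by (simp add: bounded_patterns_def to_pattern_def)
    qed
  qed
  then have "card (bounded_patterns n (n - 3)) = card ?F" by (rule bij_betw_same_card)
  then show ?thesis
    using assms by (simp add: J_any_eq_card_bounded_patterns avoids_cells_iff)
qed

theorem mainTheorem3:
  fixes n :: nat
  assumes "n \<ge> 3"
  shows "real (J_any n (n - 3)) =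
    (\<Sum>k = 0..n. (- 1) ^ k * (2 * real n / (2 * real n - real k)) *
       real ((2 * n - k) choose k) * fact (n - k))"
  using card_menage_permutations[OF assms] J_any_eq_card_permutations[OF assms] by simp

end
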